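(* Let $k$ and $l$ be positive integers. Then every positive rational number $q$ can be written as $$q=\frac{\varphi(k(m^{2}-1))}{\varphi(ln^{2})}$$ for some $m,n\in\mathbb{N}$.
   Context: $\mathbb{N}$ denotes the set of all positive integers. For $n\in\mathbb{N}$, $\varphi(n)$ is Euler's totient function, i.e. the number of positive integers up to $n$ that are relatively prime to $n$. (In particular the argument $k(m^2-1)$ is understood to be a positive integer.) *)

theory Defs
  imports "HOL-Number_Theory.Number_Theory"
begin

end

theory Submission
  imports Defs "HOL-Analysis.Kronecker_Approximation_Theorem"
begin

text \<open>
  Write \<open>q * l / k = a / b\<close> with positive integers \<open>a\<close>, \<open>b\<close>. The totient is linear in factors
  that bring in no new primes: \<open>totient (c * w) = c * totient w\<close> whenever \<open>c dvd w\<close>. So if the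
  values at which the totient is taken are fixed multiples of one highly divisible number \<open>w\<close>,
  their totients are in the same ratio as the values themselves.

  Solutions of a Pell equation \<open>x\<^sup>2 - d * y\<^sup>2 = 1\<close> with \<open>y\<close> highly divisible turn
  \<open>k * (x\<^sup>2 - 1)\<close> into such a multiple, namely \<open>k * d * y\<^sup>2\<close>. Taking \<open>n\<close> to be a multiple of
  \<open>y\<close>, this realises \<open>q\<close> as soon as \<open>d\<close> and \<open>a * b\<close> agree up to a square factor. If \<open>a * b\<close>
  is not a perfect square, \<open>d = a * b\<close> works with \<open>n = b * y\<close>
  (\<open>totient_quotient_nonsquare\<close>).

  If \<open>a * b\<close> is a perfect square, that equation has only trivial solutions. The remedy is a prime
  \<open>p\<close> which divides the numerator exactly once and the denominator not at all: it contributes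
  \<open>p - 1\<close> to the totient although \<open>p\<close> is what divides the argument. With \<open>d = p * (p - 1)\<close>, which is
  never a square, the factor \<open>d\<close> becomes the square \<open>(p - 1)\<^sup>2\<close> under the totient, which is
  exactly what is needed (\<open>totient_quotient_square\<close>). Here \<open>y\<close> must be divisible by a prescribed
  \<open>M\<close> but not by \<open>p\<close>. The explicit solution \<open>(2 * p - 1, 2)\<close> has powers \<open>(x\<^sub>t, y\<^sub>t)\<close> with
  \<open>y\<^sub>t\<close> congruent to \<open>2 * t\<close> modulo \<open>p\<close> up to sign, while by the pigeonhole principle some
  \<open>t \<le> M\<^sup>2\<close> gives \<open>M dvd y\<^sub>t\<close>; so any prime \<open>p\<close> above \<open>M\<^sup>2\<close> and \<open>2\<close> will do
  (\<open>pell_prime_solution\<close>).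
\<close>

section \<open>Totients and factors without new primes\<close>

lemma totient_mult_dvd:
  fixes c w :: nat
  assumes "c dvd w" "c > 0"
  shows "totient (c * w) = c * totient w"
proof -
  have "totient (c * w) = totient c * totient w * c div totient c"
    using totient_mult[of c w] assms by (simp add: gcd_proj1_if_dvd)
  then show ?thesis using assms by (simp add: mult.assoc)
qed

section \<open>Solvability of the Pell equation\<close>

lemma sqrt_irrational:
  fixes d :: nat
  assumes "\<nexists>s. d = s\<^sup>2"
  shows "sqrt (real d) \<notin> \<rat>"
proof
  assume "sqrt (real d) \<in> \<rat>"
  then obtain a b :: nat where ab: "b \<noteq> 0" "\<bar>sqrt (real d)\<bar> = real a / real b" "coprime a b"
    by (rule Rats_abs_nat_div_natE)
  then have "real d = (real a / real b)\<^sup>2"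
    by (metis abs_of_nonneg of_nat_0_le_iff real_sqrt_ge_zero real_sqrt_pow2)
  then have "real (d * b\<^sup>2) = real (a\<^sup>2)"
    using ab by (simp add: field_simps)
  then have eq: "d * b\<^sup>2 = a\<^sup>2" by (simp only: of_nat_eq_iff)
  then have "b\<^sup>2 dvd a\<^sup>2" by (metis dvd_triv_right)
  then have "b = 1"
    using ab by (metis coprime_common_divisor_nat dvd_refl pow_divides_pow_iff zero_less_numeral)
  with eq assms show False by auto
qed

text \<open>
  The norm factors as \<open>(h - k * sqrt d) * (h + k * sqrt d)\<close>. For a good approximation the first
  factor is below \<open>1 / k\<close>, and the second is of order \<open>2 * k * sqrt d\<close>, so the dependence on \<open>k\<close>
  cancels.
\<close>
lemma small_norm_bound:
  fixes h k :: int and d :: nat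
  assumes "(h, k) \<in> approx_set (sqrt d)"
  shows "real_of_int \<bar>h\<^sup>2 - d * k\<^sup>2\<bar> \<le> 2 * sqrt d + 1"
proof -
  define e where "e = real_of_int h - k * sqrt d"
  have k: "k > 0" and ap: "\<bar>sqrt d - of_int h / of_int k\<bar> < 1 / (of_int k)\<^sup>2"
    using assms by (auto simp: approx_set_def)
  have "\<bar>e\<bar> = k * \<bar>sqrt d - of_int h / of_int k\<bar>"
  proof -
    have "e = - (k * (sqrt d - of_int h / of_int k))" 
      using k by (simp add: e_def field_simps)
    then show ?thesis using k by (simp add: abs_mult)
  qed
  also have "\<dots> < k * (1 / (of_int k)\<^sup>2)"
    using ap k by (intro mult_strict_left_mono) auto
  also have "\<dots> = 1 / k" using k by (simp add: power2_eq_square)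
  finally have e: "\<bar>e\<bar> < 1 / k" .
  have e1: "\<bar>e\<bar> \<le> 1" 
  proof -
    have "1 / real_of_int k \<le> 1" using k by simp
    with e show ?thesis by linarith
  qed
  have "real_of_int (h\<^sup>2 - d * k\<^sup>2) = e * (e + 2 * k * sqrt d)"
    by (simp add: e_def algebra_simps power2_eq_square)
  then have "\<bar>real_of_int (h\<^sup>2 - d * k\<^sup>2)\<bar> = \<bar>e\<bar> * \<bar>e + 2 * k * sqrt d\<bar>"
    by (simp add: abs_mult)
  also have "\<dots> \<le> \<bar>e\<bar> * (\<bar>e\<bar> + 2 * k * sqrt d)"
    using k by (intro mult_left_mono) (auto intro: order_trans[OF abs_triangle_ineq])
  also have "\<dots> = \<bar>e\<bar> * \<bar>e\<bar> + (\<bar>e\<bar> * k) * (2 * sqrt d)"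
    by (simp add: algebra_simps)
  also have "\<dots> \<le> 1 + 1 * (2 * sqrt d)"
  proof (intro add_mono mult_right_mono)
    show "\<bar>e\<bar> * \<bar>e\<bar> \<le> 1" using mult_le_one[OF e1 abs_ge_zero e1] .
    show "\<bar>e\<bar> * k \<le> 1" using e k by (simp add: field_simps)
  qed simp
  finally show ?thesis by simp
qed

text \<open>
  A pigeonhole argument: \<open>sqrt d\<close> has infinitely many good rational approximations, all of bounded
  norm, so two of them have the same norm \<open>K\<close> and are congruent modulo \<open>K\<close>. Their quotient in the
  field generated by \<open>sqrt d\<close> is then an integral element of norm 1.
\<close>
lemma pell_solution:
  fixes d :: nat
  assumes nsq: "\<nexists>s. d = s\<^sup>2"
  obtains x y :: nat where "y > 0" "x\<^sup>2 = d * y\<^sup>2 + 1"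
proof -
  define A where "A = approx_set (sqrt d)"
  define B where "B = \<lceil>2 * sqrt d + 1\<rceil>"
  define N where "N = (\<lambda>(h::int, k::int). h\<^sup>2 - d * k\<^sup>2)"
  define f where "f = (\<lambda>z. (N z, fst z mod N z, snd z mod N z))"
  have A: "coprime h k" "k > 0" if "(h, k) \<in> A" for h k
    using that by (auto simp: A_def approx_set_def)
  have N0: "N z \<noteq> 0" if "z \<in> A" for z
  proof
    assume "N z = 0"
    moreover obtain h k where z: "z = (h, k)" by fastforce
    ultimately have "h\<^sup>2 = int d * k\<^sup>2" by (simp add: N_def)
    then have "\<bar>real_of_int h\<bar> = sqrt d * k"
      using A[of h k] that z
      by (metis of_int_0_le_iff of_int_mult of_int_of_nat_eq of_int_power order_less_imp_le
           real_sqrt_abs real_sqrt_mult real_sqrt_unique)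
    then have "sqrt d = of_int \<bar>h\<bar> / of_int k" using A[of h k] that z by (simp add: field_simps)
    then have "sqrt d \<in> \<rat>" by (metis Rats_divide Rats_of_int)
    with sqrt_irrational[OF nsq] show False by blast
  qed
  have NB: "\<bar>N z\<bar> \<le> B" if "z \<in> A" for z
  proof -
    have "real_of_int \<bar>N z\<bar> \<le> 2 * sqrt d + 1"
      using small_norm_bound[of "fst z" "snd z" d] that
      by (auto simp: A_def N_def case_prod_unfold)
    then show ?thesis unfolding B_def by linarith
  qed
  have "f ` A \<subseteq> {-B..B} \<times> {-B..B} \<times> {-B..B}"
  proof
    fix w assume "w \<in> f ` A"
    then obtain z where z: "z \<in> A" "w = f z" by blast
    have "\<bar>a mod N z\<bar> \<le> B" for a
      using abs_mod_less[OF N0[OF z(1)], of a] NB[OF z(1)] by linarith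
    with NB[OF z(1)] z(2) show "w \<in> {-B..B} \<times> {-B..B} \<times> {-B..B}"
      by (auto simp: f_def abs_le_iff minus_le_iff)
  qed
  then have "finite (f ` A)" by (rule finite_subset) simp
  moreover have "infinite A"
    using rational_iff_finite_approx_set sqrt_irrational[OF nsq] by (simp add: A_def)
  ultimately obtain z0 where z0: "z0 \<in> A" "infinite {z \<in> A. f z = f z0}"
    using pigeonhole_infinite by blast
  then have "infinite ({z \<in> A. f z = f z0} - {z0})" by simp
  then obtain z1 where z1: "z1 \<in> A" "f z1 = f z0" "z1 \<noteq> z0"
    by (metis (mono_tags, lifting) DiffE all_not_in_conv finite.emptyI insertCI mem_Collect_eq)
  obtain h k where hk: "z0 = (h, k)" by fastforce
  obtain h' k' where hk': "z1 = (h', k')" by fastforce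
  define K where "K = N z0"
  have K0: "K \<noteq> 0" using N0 z0 by (simp add: K_def)
  have K: "h\<^sup>2 - d * k\<^sup>2 = K" "h'\<^sup>2 - d * k'\<^sup>2 = K"
    using z1(2) hk hk' by (auto simp: K_def f_def N_def)
  have cong: "[h' = h] (mod K)" "[k' = k] (mod K)"
    using z1(2) hk hk' by (auto simp: K_def f_def Cong.cong_def)
  \<comment> \<open>\<open>X\<close> and \<open>Y\<close> are the coordinates of \<open>(h' + k' * sqrt d) / (h + k * sqrt d)\<close>, up to the sign of
    \<open>Y\<close>: multiply by the conjugate of the denominator and divide by its norm \<open>K\<close>.\<close>
  have "[h' * h - d * (k' * k) = h * h - d * (k * k)] (mod K)"
    by (intro cong_diff cong_mult cong_refl cong)
  moreover have "h * h - d * (k * k) = K" using K(1) by (simp add: power2_eq_square)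
  ultimately have "K dvd h' * h - d * (k' * k)"
    by (metis cong_dvd_iff dvd_refl)
  then obtain X where X: "h' * h - d * (k' * k) = K * X" ..
  have "[h' * k - h * k' = h * k - h * k] (mod K)"
    by (intro cong_diff cong_mult cong_refl cong)
  then have "K dvd h' * k - h * k'" by (simp add: cong_0_iff)
  then obtain Y where Y: "h' * k - h * k' = K * Y" ..
  have "K\<^sup>2 * (X\<^sup>2 - d * Y\<^sup>2) = (K * X)\<^sup>2 - d * (K * Y)\<^sup>2"
    by (simp add: algebra_simps power2_eq_square)
  also have "\<dots> = (h\<^sup>2 - d * k\<^sup>2) * (h'\<^sup>2 - d * k'\<^sup>2)"
    unfolding X[symmetric] Y[symmetric] by (simp add: algebra_simps power2_eq_square)
  also have "\<dots> = K\<^sup>2 * 1" unfolding K by (simp add: power2_eq_square)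
  finally have XY: "X\<^sup>2 - d * Y\<^sup>2 = 1" using K0 by simp
  \<comment> \<open>The approximations are fractions in lowest terms, so distinct pairs have distinct values.\<close>
  have "Y \<noteq> 0"
  proof
    assume "Y = 0"
    then have eq: "h' * k = h * k'" using Y by simp
    have co: "coprime h k" "k > 0" "coprime h' k'" "k' > 0"
      using A z0 z1 hk hk' by auto
    have "k dvd k'" "k' dvd k" using eq co
      by (metis coprime_commute coprime_dvd_mult_right_iff dvd_triv_right)
         (metis eq co(3) coprime_commute coprime_dvd_mult_right_iff dvd_triv_right)
    then have "k = k'" using co by (simp add: zdvd_antisym_nonneg)
    with eq co hk hk' z1(3) show False by simp
  qed
  show ?thesis
  proof (rule that[of "nat \<bar>Y\<bar>" "nat \<bar>X\<bar>"])
    have "int ((nat \<bar>X\<bar>)\<^sup>2) = int (d * (nat \<bar>Y\<bar>)\<^sup>2 + 1)" using XY by simp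
    then show "(nat \<bar>X\<bar>)\<^sup>2 = d * (nat \<bar>Y\<bar>)\<^sup>2 + 1" by (simp only: of_nat_eq_iff)
  qed (use \<open>Y \<noteq> 0\<close> in simp)
qed

text \<open>
  A solution for \<open>d * M\<^sup>2\<close> is a solution for \<open>d\<close> whose second coordinate carries a factor \<open>M\<close>.
\<close>
lemma pell_solution_dvd:
  fixes d M :: nat
  assumes nsq: "\<nexists>s. d = s\<^sup>2" and M: "M > 0"
  obtains x y :: nat where "y > 0" "M dvd y" "x\<^sup>2 = d * y\<^sup>2 + 1"
proof -
  have "\<nexists>s. d * M\<^sup>2 = s\<^sup>2"
  proof
    assume "\<exists>s. d * M\<^sup>2 = s\<^sup>2"
    then obtain s where s: "d * M\<^sup>2 = s\<^sup>2" ..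
    then have "M dvd s" by (metis dvd_triv_right pow_divides_pow_iff zero_less_numeral)
    then obtain t where "s = M * t" ..
    with s M have "d = t\<^sup>2" by (simp add: power_mult_distrib)
    with nsq show False by blast
  qed
  then obtain x y :: nat where "y > 0" "x\<^sup>2 = d * M\<^sup>2 * y\<^sup>2 + 1" by (rule pell_solution)
  with M show ?thesis by (intro that[of "M * y" x]) (auto simp: power_mult_distrib)
qed

section \<open>Powers of a solution\<close>

text \<open>The product of \<open>a + b * sqrt d\<close> and \<open>x + y * sqrt d\<close>, in coordinates.\<close>
fun pell_mult :: "int \<Rightarrow> int \<times> int \<Rightarrow> int \<times> int \<Rightarrow> int \<times> int" where
  "pell_mult d (a, b) (x, y) = (a * x + d * b * y, a * y + b * x)"

primrec pell_power :: "int \<Rightarrow> int \<times> int \<Rightarrow> nat \<Rightarrow> int \<times> int" where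
  "pell_power d z 0 = (1, 0)"
| "pell_power d z (Suc n) = pell_mult d z (pell_power d z n)"

lemma pell_power_add:
  "pell_power d z (m + n) = pell_mult d (pell_power d z m) (pell_power d z n)"
proof (induction m)
  case 0
  then show ?case by (cases "pell_power d z n") simp
next
  case (Suc m)
  then show ?case
    by (cases z; cases "pell_power d z m"; cases "pell_power d z n") (simp add: algebra_simps)
qed

lemma pell_power_norm:
  assumes "u\<^sup>2 - d * v\<^sup>2 = 1" "pell_power d (u, v) n = (x, y)"
  shows "x\<^sup>2 - d * y\<^sup>2 = 1"
  using assms(2)
proof (induction n arbitrary: x y)
  case (Suc n)
  obtain x' y' where xy': "pell_power d (u, v) n = (x', y')" by fastforce
  have "x\<^sup>2 - d * y\<^sup>2 = (u\<^sup>2 - d * v\<^sup>2) * (x'\<^sup>2 - d * y'\<^sup>2)"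
    using Suc.prems xy' by (auto simp: algebra_simps power2_eq_square)
  with Suc.IH[OF xy'] assms(1) show ?case by simp
qed simp

text \<open>
  Among the powers with exponents \<open>0, \<dots>, M\<^sup>2\<close> two agree modulo \<open>M\<close>; dividing one by the other,
  which is possible since elements of norm 1 are invertible, gives a positive power congruent
  to 1. What matters below is the bound on the exponent.
\<close>
lemma pell_power_dvd:
  fixes M :: nat
  assumes uv: "u\<^sup>2 - d * v\<^sup>2 = 1" and M: "M > 0"
  obtains t where "0 < t" "t \<le> M\<^sup>2" "int M dvd snd (pell_power d (u, v) t)"
proof -
  define P where "P = pell_power d (u, v)"
  define f where "f = (\<lambda>n. (fst (P n) mod int M, snd (P n) mod int M))"
  define R where "R = {0..<int M} \<times> {0..<int M}"
  have "f ` {0..M\<^sup>2} \<subseteq> R" using M by (auto simp: f_def R_def)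
  then have "card (f ` {0..M\<^sup>2}) \<le> card R" by (intro card_mono) (simp_all add: R_def)
  also have "\<dots> < card {0..M\<^sup>2}" by (simp add: R_def power2_eq_square)
  finally have "\<not> inj_on f {0..M\<^sup>2}" by (rule pigeonhole)
  then obtain i j where "i \<le> M\<^sup>2" "j \<le> M\<^sup>2" "i \<noteq> j" "f i = f j"
    by (auto simp: inj_on_def)
  then obtain i j where ij: "i < j" "j \<le> M\<^sup>2" "f i = f j"
    by (metis linorder_neqE_nat)
  obtain x y where xy: "P i = (x, y)" by fastforce
  obtain x' y' where xy': "P j = (x', y')" by fastforce
  obtain s w where sw: "P (j - i) = (s, w)" by fastforce
  have "P (i + (j - i)) = pell_mult d (P i) (P (j - i))"
    unfolding P_def by (rule pell_power_add)
  then have eq: "x' = x * s + d * y * w" "y' = x * w + y * s"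
    using ij xy xy' sw by auto
  have cong: "[x' = x] (mod M)" "[y' = y] (mod M)"
    using ij(3) xy xy' by (simp_all add: f_def Cong.cong_def)
  have "x\<^sup>2 - d * y\<^sup>2 = 1" using pell_power_norm[OF uv] xy by (simp add: P_def)
  \<comment> \<open>Solve the two equations for \<open>w\<close> by multiplying with the conjugate of \<open>(x, y)\<close>.\<close>
  then have "w = w * (x\<^sup>2 - d * y\<^sup>2)" by simp
  also have "\<dots> = x * y' - y * x'" by (simp add: eq algebra_simps power2_eq_square)
  also have "[x * y' - y * x' = x * y - y * x] (mod M)"
    by (intro cong_diff cong_mult cong_refl cong)
  finally have "int M dvd w" by (simp add: cong_0_iff)
  with ij sw show ?thesis by (intro that[of "j - i"]) (auto simp: P_def)
qed

text \<open>
  Modulo \<open>p\<close> the square root of \<open>p * (p - 1)\<close> is a nilpotent \<open>\<epsilon>\<close>, so the base is \<open>- 1 + 2 * \<epsilon>\<close>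
  and its \<open>n\<close>-th power is \<open>(- 1) ^ n * (1 - 2 * n * \<epsilon>)\<close>.
\<close>
lemma pell_power_cong:
  fixes p :: int
  assumes "pell_power (p * (p - 1)) (2 * p - 1, 2) n = (x, y)"
  shows "[x = (-1) ^ n] (mod p) \<and> [y = - 2 * int n * (-1) ^ n] (mod p)"
  using assms
proof (induction n arbitrary: x y)
  case (Suc n)
  obtain x' y' where xy': "pell_power (p * (p - 1)) (2 * p - 1, 2) n = (x', y')" by fastforce
  from Suc.IH[OF xy'] obtain a b where
    ab: "x' = (-1) ^ n + p * a" "y' = - 2 * int n * (-1) ^ n + p * b"
    by (metis cong_iff_lin cong_sym)
  have x: "x = (2 * p - 1) * x' + p * (p - 1) * 2 * y'" and y: "y = (2 * p - 1) * y' + 2 * x'"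
    using Suc.prems xy' by auto
  have "x - (-1) ^ Suc n = p * (2 * x' - a + (p - 1) * 2 * y')"
    by (simp add: x ab(1) algebra_simps)
  moreover have "y - (- 2 * int (Suc n) * (-1) ^ Suc n) = p * (2 * y' - b + 2 * a)"
    by (simp add: y ab algebra_simps)
  ultimately show ?case by (simp add: cong_iff_dvd_diff)
qed simp

text \<open>
  The exponent \<open>t \<le> M\<^sup>2\<close> that makes the second coordinate divisible by \<open>M\<close> is too small to be
  divisible by \<open>p\<close>, hence that coordinate, which is \<open>2 * t\<close> up to sign modulo \<open>p\<close>, is not
  divisible by \<open>p\<close> either.
\<close>
lemma pell_prime_solution:
  fixes p M :: nat
  assumes p: "prime p" "p > 2" "p > M\<^sup>2" and M: "M > 0"
  obtains x y :: nat where "y > 0" "M dvd y" "\<not> p dvd y" "x\<^sup>2 = p * (p - 1) * y\<^sup>2 + 1"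
proof -
  define d where "d = int p * (int p - 1)"
  have uv: "(2 * int p - 1)\<^sup>2 - d * 2\<^sup>2 = 1"
    by (simp add: d_def algebra_simps power2_eq_square)
  obtain t where t: "0 < t" "t \<le> M\<^sup>2" "int M dvd snd (pell_power d (2 * int p - 1, 2) t)"
    using pell_power_dvd[OF uv M] .
  obtain x y where xy: "pell_power d (2 * int p - 1, 2) t = (x, y)" by fastforce
  have "\<not> int p dvd y"
  proof
    assume "int p dvd y"
    then have "int p dvd - 2 * int t * (-1) ^ t"
      using pell_power_cong[of "int p" t x y] xy by (metis cong_dvd_iff d_def)
    then have "int p dvd int (2 * t)" by (cases "even t") auto
    then have "p dvd 2 * t" by (simp only: of_nat_dvd_iff)
    then have "p dvd 2 \<or> p dvd t" using p by (simp add: prime_dvd_mult_iff)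
    then show False using p t by (auto dest!: dvd_imp_le)
  qed
  moreover have "x\<^sup>2 - d * y\<^sup>2 = 1" using pell_power_norm[OF uv xy] .
  then have "int ((nat \<bar>x\<bar>)\<^sup>2) = int (p * (p - 1) * (nat \<bar>y\<bar>)\<^sup>2 + 1)"
    using p by (simp add: d_def of_nat_diff)
  then have "(nat \<bar>x\<bar>)\<^sup>2 = p * (p - 1) * (nat \<bar>y\<bar>)\<^sup>2 + 1" by (simp only: of_nat_eq_iff)
  ultimately show ?thesis using t(3) xy
    by (intro that[of "nat \<bar>y\<bar>" "nat \<bar>x\<bar>"]) (auto simp: nat_dvd_iff dvd_nat_abs_iff)
qed

section \<open>Realising a prescribed quotient\<close>

text \<open>
  For \<open>x\<^sup>2 - a * b * y\<^sup>2 = 1\<close> and \<open>n = b * y\<close> the two arguments of the totient are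
  \<open>k * a * b * y\<^sup>2\<close> and \<open>l * b\<^sup>2 * y\<^sup>2\<close>. When \<open>y\<close> is divisible by \<open>k\<close>, \<open>l\<close>, \<open>a\<close> and \<open>b\<close>, their
  totients are \<open>k * a * b\<close> and \<open>l * b\<^sup>2\<close> times \<open>totient (y\<^sup>2)\<close>.
\<close>
lemma totient_quotient_nonsquare:
  fixes k l a b :: nat
  assumes pos: "k > 0" "l > 0" "a > 0" "b > 0" and nsq: "\<nexists>s. a * b = s\<^sup>2"
  obtains m n :: nat where "n > 0" "m\<^sup>2 > 1"
    "l * b * totient (k * (m\<^sup>2 - 1)) = k * a * totient (l * n\<^sup>2)"
proof -
  obtain x y where y: "y > 0" "k * l * a * b dvd y" and x: "x\<^sup>2 = a * b * y\<^sup>2 + 1"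
  proof (rule pell_solution_dvd[OF nsq])
    show "k * l * a * b > 0" using pos by simp
  qed
  have "k * a * b dvd y" using y(2) by (rule dvd_trans[rotated]) simp
  then have dvd1: "k * a * b dvd y\<^sup>2" by (simp add: power2_eq_square)
  have "l * b dvd y" "b dvd y" using y(2) by (auto elim!: dvd_trans[rotated])
  then have dvd2: "l * b\<^sup>2 dvd y\<^sup>2"
    using mult_dvd_mono[of "l * b" y b y] by (simp add: power2_eq_square ac_simps)
  have "k * (x\<^sup>2 - 1) = k * a * b * y\<^sup>2" by (simp add: x)
  moreover have "totient (k * a * b * y\<^sup>2) = k * a * b * totient (y\<^sup>2)"
    using totient_mult_dvd[OF dvd1] pos by simp
  ultimately have 1: "totient (k * (x\<^sup>2 - 1)) = k * a * b * totient (y\<^sup>2)"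
    by (simp only:)
  have "l * (b * y)\<^sup>2 = l * b\<^sup>2 * y\<^sup>2" by (simp add: power_mult_distrib)
  moreover have "totient (l * b\<^sup>2 * y\<^sup>2) = l * b\<^sup>2 * totient (y\<^sup>2)"
    using totient_mult_dvd[OF dvd2] pos by simp
  ultimately have 2: "totient (l * (b * y)\<^sup>2) = l * b\<^sup>2 * totient (y\<^sup>2)"
    by (simp only:)
  show ?thesis
  proof (rule that[of "b * y" x])
    show "b * y > 0" "x\<^sup>2 > 1" using pos y by (simp_all add: x)
    show "l * b * totient (k * (x\<^sup>2 - 1)) = k * a * totient (l * (b * y)\<^sup>2)"
      unfolding 1 2 by (simp add: power2_eq_square)
  qed
qed

text \<open>
  For \<open>x\<^sup>2 - p * (p - 1) * (s * z)\<^sup>2 = 1\<close> and \<open>n = b * (p - 1) * z\<close> let \<open>w = (p - 1) * z\<^sup>2\<close>. The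
  arguments of the totient are \<open>p * k * s\<^sup>2 * w\<close>, with \<open>p\<close> coprime to the rest, and
  \<open>l * b\<^sup>2 * (p - 1) * w\<close>. The factor \<open>p\<close> of the first turns into \<open>p - 1\<close> and cancels against
  the second, and \<open>s\<^sup>2 = a * b\<close> gives the quotient \<open>k * a / (l * b)\<close>.
\<close>
lemma totient_quotient_square:
  fixes k l a b s :: nat
  assumes pos: "k > 0" "l > 0" "a > 0" "b > 0" and sq: "a * b = s\<^sup>2"
  obtains m n :: nat where "n > 0" "m\<^sup>2 > 1"
    "l * b * totient (k * (m\<^sup>2 - 1)) = k * a * totient (l * n\<^sup>2)"
proof -
  have s: "s > 0" using pos sq by (cases s) auto
  define c where "c = k * l * s * b"
  \<comment> \<open>The extra factor \<open>s\<close> leaves \<open>z = y / s\<close> still divisible by \<open>c\<close>.\<close>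
  define M where "M = s * c"
  have M: "M > 0" using pos s by (simp add: M_def c_def)
  obtain p where p: "prime p" "p > M\<^sup>2 + 2" using bigger_prime by blast
  obtain x y where y: "y > 0" "M dvd y" "\<not> p dvd y" and x: "x\<^sup>2 = p * (p - 1) * y\<^sup>2 + 1"
  proof (rule pell_prime_solution)
    show "prime p" "p > 2" "p > M\<^sup>2" "M > 0" using p M by auto
  qed
  obtain e where e: "y = M * e" using y(2) ..
  define z where "z = c * e"
  have yz: "y = s * z" and cz: "c dvd z" and z: "z > 0"
    using y(1) by (auto simp: e M_def z_def)
  define w where "w = (p - 1) * z\<^sup>2"
  have "k * s dvd z" "s dvd z" "l * b dvd z" "b dvd z"
    using cz unfolding c_def by (auto elim!: dvd_trans[rotated])
  then have "k * s * s dvd z * z" "l * b * b dvd z * z"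
    by (auto intro: mult_dvd_mono)
  then have "k * s\<^sup>2 dvd z\<^sup>2" "l * b\<^sup>2 dvd z\<^sup>2"
    by (simp_all add: power2_eq_square mult.assoc)
  then have dvd1: "k * s\<^sup>2 dvd w" and dvd2: "l * b\<^sup>2 * (p - 1) dvd w"
    unfolding w_def by (simp, metis dvd_refl mult.commute mult_dvd_mono)
  have "k dvd M" by (simp add: M_def c_def)
  then have "k \<le> M" using M by (rule dvd_imp_le)
  moreover have "M \<le> M\<^sup>2" by (simp add: power2_nat_le_imp_le power2_eq_square)
  ultimately have "k < p" using p by linarith
  then have "\<not> p dvd k" using pos by (auto dest: dvd_imp_le)
  moreover have "\<not> p dvd p - 1" using p by (auto dest: dvd_imp_le)
  moreover have "\<not> p dvd s" "\<not> p dvd z" using y(3) by (auto simp: yz)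
  ultimately have "\<not> p dvd k * s\<^sup>2 * w"
    using p(1) by (simp add: w_def prime_dvd_mult_iff prime_dvd_power_iff)
  then have "coprime p (k * s\<^sup>2 * w)" using p(1) by (intro prime_imp_coprime)
  moreover have "k * (x\<^sup>2 - 1) = p * (k * s\<^sup>2 * w)"
    by (simp add: x yz w_def power_mult_distrib)
  ultimately have "totient (k * (x\<^sup>2 - 1)) = (p - 1) * totient (k * s\<^sup>2 * w)"
    using p(1) by (simp only: totient_mult_coprime totient_prime)
  then have 1: "totient (k * (x\<^sup>2 - 1)) = (p - 1) * (k * s\<^sup>2) * totient w"
    using totient_mult_dvd[OF dvd1] pos s by simp
  have "l * (b * (p - 1) * z)\<^sup>2 = l * b\<^sup>2 * (p - 1) * w"
    by (simp add: w_def power2_eq_square)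
  moreover have "totient (l * b\<^sup>2 * (p - 1) * w) = l * b\<^sup>2 * (p - 1) * totient w"
    using totient_mult_dvd[OF dvd2] pos p by simp
  ultimately have 2: "totient (l * (b * (p - 1) * z)\<^sup>2) = l * b\<^sup>2 * (p - 1) * totient w"
    by (simp only:)
  show ?thesis
  proof (rule that[of "b * (p - 1) * z" x])
    show "b * (p - 1) * z > 0" using pos p z by simp
    show "x\<^sup>2 > 1" using p y(1) by (simp add: x)
    show "l * b * totient (k * (x\<^sup>2 - 1)) = k * a * totient (l * (b * (p - 1) * z)\<^sup>2)"
      unfolding 1 2 sq[symmetric] by (simp add: power2_eq_square)
  qed
qed

theorem theorem1p2:
  fixes k l :: nat and q :: rat
  assumes "k > 0" and "l > 0" and "q > 0"
  shows "\<exists>m n :: nat. m > 0 \<and> n > 0 \<and> k * (m\<^sup>2 - 1) > 0 \<and>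
           q = of_nat (totient (k * (m\<^sup>2 - 1))) / of_nat (totient (l * n\<^sup>2))"
proof -
  obtain u v where uv: "q = of_int u / of_int v" "v > 0"
    using quotient_of_div quotient_of_denom_pos by (metis prod.exhaust)
  with assms(3) have "u > 0" by (simp add: zero_less_divide_iff)
  \<comment> \<open>Thus \<open>a / b = q * l / k\<close>.\<close>
  define a b where "a = nat u * l" and "b = nat v * k"
  have ab: "a > 0" "b > 0" using assms \<open>u > 0\<close> uv by (auto simp: a_def b_def)
  obtain m n :: nat where n: "n > 0" and m: "m\<^sup>2 > 1"
    and eq: "l * b * totient (k * (m\<^sup>2 - 1)) = k * a * totient (l * n\<^sup>2)"
  proof (cases "\<exists>s. a * b = s\<^sup>2")
    case True
    then show ?thesis
      using totient_quotient_square[OF assms(1,2) ab] that by blast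
  next
    case False
    then show ?thesis
      using totient_quotient_nonsquare[OF assms(1,2) ab] that by blast
  qed
  have "l * k * (nat v * totient (k * (m\<^sup>2 - 1))) = l * k * (nat u * totient (l * n\<^sup>2))"
    using eq by (simp add: a_def b_def ac_simps)
  then have "nat v * totient (k * (m\<^sup>2 - 1)) = nat u * totient (l * n\<^sup>2)"
    using assms by simp
  then have "of_int v * (of_nat (totient (k * (m\<^sup>2 - 1))) :: rat)
           = of_int u * of_nat (totient (l * n\<^sup>2))"
    using uv \<open>u > 0\<close> by (metis of_int_of_nat_eq of_nat_mult int_nat_eq order_less_imp_le)
  moreover have "totient (l * n\<^sup>2) > 0" using assms n by simp
  ultimately have "q = of_nat (totient (k * (m\<^sup>2 - 1))) / of_nat (totient (l * n\<^sup>2))"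
    unfolding uv(1) using uv(2) by (subst frac_eq_eq) (simp_all add: mult.commute)
  moreover have "m > 0" using m by (cases m) auto
  ultimately show ?thesis using assms n m by auto
qed

end
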